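(* Let $\Bbbk$ be a field. For every noncommutative Novikov algebra $(D,\prec,\succ)$ over $\Bbbk$ there exists an associative algebra $A$ over $\Bbbk$ with a derivation $d$ such that $D$ embeds into $A^{(d)}$; that is, there is an injective linear map $\iota:D\to A$ such that $\iota(a\prec b)=\iota(a)\,d(\iota(b))$ and $\iota(a\succ b)=d(\iota(a))\,\iota(b)$ for all $a,b\in D$.
   Context: A noncommutative Novikov algebra (also called a derived associative algebra, or $D\mathrm{As}$-algebra) over a field $\Bbbk$ is a $\Bbbk$-vector space equipped with two bilinear operations $\prec$ and $\succ$ satisfying, for all $x,y,z$, $$x\succ (y\prec z) = (x\succ y)\prec z,$$ $$(x\prec y)\succ z - x\succ (y\succ z) = x\prec (y\succ z) - (x\prec y)\prec z.$$ Associative algebras are not necessarily commutative and not assumed to be unital. A derivation of $A$ is a linear map $d:A\to A$ with $d(ab)=d(a)b+ad(b)$. For an associative algebra $A$ with derivation $d$, $A^{(d)}$ denotes the space $A$ equipped with the operations $a\prec b = a\,d(b)$, $a\succ b = d(a)\,b$; this is a noncommutative Novikov algebra. *)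

theory Defs
  imports Complex_Main "HOL-Library.Poly_Mapping"
begin

definition bilinear_op ::
    "('k::field \<Rightarrow> 'a::ab_group_add \<Rightarrow> 'a) \<Rightarrow> ('a \<Rightarrow> 'a \<Rightarrow> 'a) \<Rightarrow> bool" where
  "bilinear_op scale f \<longleftrightarrow>
     (\<forall>x. Vector_Spaces.linear scale scale (\<lambda>y. f x y)) \<and>
     (\<forall>y. Vector_Spaces.linear scale scale (\<lambda>x. f x y))"

locale nc_novikov_algebra = vector_space scale
  for scale :: "'k::field \<Rightarrow> 'a::ab_group_add \<Rightarrow> 'a" +
  fixes prec :: "'a \<Rightarrow> 'a \<Rightarrow> 'a"  (infixl \<open>\<prec>\<close> 70)
    and succ :: "'a \<Rightarrow> 'a \<Rightarrow> 'a"  (infixl \<open>\<succ>\<close> 70)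
  assumes bilinear_prec: "bilinear_op scale prec"
    and bilinear_succ: "bilinear_op scale succ"
    and succ_prec: "x \<succ> (y \<prec> z) = (x \<succ> y) \<prec> z"
    and assoc_defect: "(x \<prec> y) \<succ> z - x \<succ> (y \<succ> z) = x \<prec> (y \<succ> z) - (x \<prec> y) \<prec> z"

text \<open>Neither commutativity nor a unit is required.\<close>

locale assoc_algebra = vector_space scale
  for scale :: "'k::field \<Rightarrow> 'a::ab_group_add \<Rightarrow> 'a" +
  fixes mult :: "'a \<Rightarrow> 'a \<Rightarrow> 'a"
  assumes bilinear_mult: "bilinear_op scale mult"
    and mult_assoc: "mult (mult x y) z = mult x (mult y z)"

locale derivation_algebra = assoc_algebra scale mult
  for scale :: "'k::field \<Rightarrow> 'a::ab_group_add \<Rightarrow> 'a" and mult :: "'a \<Rightarrow> 'a \<Rightarrow> 'a" +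
  fixes d :: "'a \<Rightarrow> 'a"
  assumes linear_d: "Vector_Spaces.linear scale scale d"
    and leibniz: "d (mult a b) = mult (d a) b + mult a (d b)"

definition der_prec :: "('a \<Rightarrow> 'a \<Rightarrow> 'a) \<Rightarrow> ('a \<Rightarrow> 'a) \<Rightarrow> 'a \<Rightarrow> 'a \<Rightarrow> 'a" where
  "der_prec mult d a b = mult a (d b)"

definition der_succ :: "('a \<Rightarrow> 'a \<Rightarrow> 'a) \<Rightarrow> ('a \<Rightarrow> 'a) \<Rightarrow> 'a \<Rightarrow> 'a \<Rightarrow> 'a" where
  "der_succ mult d a b = mult (d a) b"

lemma (in derivation_algebra) derived_nc_novikov:
  "nc_novikov_algebra scale (der_prec mult d) (der_succ mult d)"
proof -
  have l1: "Vector_Spaces.linear scale scale (\<lambda>y. mult x y)"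
    and l2: "Vector_Spaces.linear scale scale (\<lambda>x. mult x y)" for x y
    using bilinear_mult by (auto simp: bilinear_op_def)
  have c1: "Vector_Spaces.linear scale scale (\<lambda>y. mult x (d y))" for x
    using Vector_Spaces.linear_compose[OF linear_d l1] by (simp add: o_def)
  have c2: "Vector_Spaces.linear scale scale (\<lambda>x. mult (d x) y)" for y
    using Vector_Spaces.linear_compose[OF linear_d l2] by (simp add: o_def)
  have addr: "mult x (y + z) = mult x y + mult x z" for x y z
    by (rule module_hom.add[OF module_hom_iff_linear[THEN iffD2, OF l1]])
  have addl: "mult (y + z) x = mult y x + mult z x" for x y z
    by (rule module_hom.add[OF module_hom_iff_linear[THEN iffD2, OF l2]])
  show ?thesis
    by unfold_locales
      (auto simp: bilinear_op_def der_prec_def der_succ_def l1 l2 c1 c2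
         leibniz mult_assoc addl addr algebra_simps)
qed

text \<open>
  HOL cannot quantify existentially over types, so an algebra asserted to exist has to live
  on a fixed type.  The one below is the space underlying the free associative algebra on
  the letters \<open>(n, a)\<close>, read as the \<open>n\<close>-th derivative of \<open>a\<close>.  It is large enough: an
  algebra with derivation that contains a copy of \<open>'a\<close> can be cut down to the part generated
  by that copy, a quotient of the (non-unital) free differential algebra, and then enlarged
  by a summand with zero multiplication and zero derivation to reach the dimension of this
  space.  Only the additive group is fixed; scalar multiplication, product and derivation
  remain arbitrary.
\<close>

type_synonym ('k, 'a) diff_words = "(nat \<times> 'a) list \<Rightarrow>\<^sub>0 'k"

end

theory Submission
  imports Defs "HOL-Library.Function_Algebras" "HOL-Library.Product_Plus"
begin

text \<open>
  It suffices to find a vector space with a linear operator \<open>\<partial>\<close> and operators \<open>X\<^sub>a\<close>, depending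
  linearly and injectively on \<open>a \<in> D\<close>, such that \<open>X\<^bsub>a \<prec> b\<^esub> = X\<^sub>a [\<partial>, X\<^sub>b]\<close> and
  \<open>X\<^bsub>a \<succ> b\<^esub> = [\<partial>, X\<^sub>a] X\<^sub>b\<close>: the operators form an associative algebra with derivation
  \<open>[\<partial>, -]\<close>, and the part generated by the \<open>X\<^sub>a\<close> is a linear image of the free algebra.

  Give \<open>a\<close> the weight \<open>-1\<close> and \<open>\<partial>\<close> the weight \<open>1\<close>.  In weight \<open>-k\<close> with \<open>k \<ge> 1\<close>, the space consists
  of \<open>k\<close>-fold tensors over \<open>D\<close> modulo \<open>(a \<prec> c) \<otimes> b = a \<otimes> (c \<succ> b)\<close>, both sides being \<open>a c' b\<close>; in
  weight \<open>n \<ge> 0\<close>, it consists of the maps \<open>f\<close> from \<open>(n + 1)\<close>-fold tensors of this kind to \<open>D\<close> that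
  commute with \<open>c \<succ> _\<close>, as \<open>n + 1\<close> factors from \<open>D\<close> bring an element of weight \<open>n\<close> down to \<open>D\<close>.
  The Leibniz rule then dictates \<open>\<partial>\<close>.  The first axiom makes \<open>c \<succ> _\<close> compatible with the
  tensor relation, and the second one makes \<open>\<partial>\<close> well defined.
\<close>

subsection \<open>From operators to an algebra on the space of words\<close>

lemma vector_space_fun:
  assumes "vector_space scale"
  shows "vector_space (\<lambda>c f x. scale c (f x))"
proof -
  interpret vector_space scale by fact
  show ?thesis by unfold_locales (auto simp: fun_eq_iff algebra_simps)
qed

lemma vector_space_prod:
  assumes "vector_space s1" "vector_space s2"
  shows "vector_space (\<lambda>c (x, y). (s1 c x, s2 c y))"
proof -
  interpret v1: vector_space s1 by fact
  interpret v2: vector_space s2 by fact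
  show ?thesis
    by unfold_locales (auto simp: v1.scale_right_distrib v2.scale_right_distrib
        v1.scale_left_distrib v2.scale_left_distrib)
qed

definition scale_words :: "'k::field \<Rightarrow> ('w \<Rightarrow>\<^sub>0 'k) \<Rightarrow> ('w \<Rightarrow>\<^sub>0 'k)" where
  "scale_words c = Poly_Mapping.map ((*) c)"

lemma lookup_scale_words [simp]: "Poly_Mapping.lookup (scale_words c p) w = c * Poly_Mapping.lookup p w"
  by (simp add: scale_words_def Poly_Mapping.map.rep_eq when_def)

lemma vector_space_scale_words: "vector_space scale_words"
  by unfold_locales (auto intro!: poly_mapping_eqI simp: lookup_add algebra_simps)

section \<open>Algebras of operators closed under the commutator with \<open>D\<close>\<close>

locale operator_model = vector_space scale
  for scale :: "'k::field \<Rightarrow> 'v::ab_group_add \<Rightarrow> 'v" +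
  fixes D :: "'v \<Rightarrow> 'v" and X :: "'a \<Rightarrow> 'v \<Rightarrow> 'v"
  assumes D_add: "D (v + w) = D v + D w"
    and D_scale: "D (scale c v) = scale c (D v)"
    and X_add: "X a (v + w) = X a v + X a w"
    and X_scale: "X a (scale c v) = scale c (X a v)"
begin

fun letter_op :: "nat \<times> 'a \<Rightarrow> 'v \<Rightarrow> 'v" where
  "letter_op (0, a) = X a"
| "letter_op (Suc n, a) = (\<lambda>v. D (letter_op (n, a) v) - letter_op (n, a) (D v))"

fun word_op :: "(nat \<times> 'a) list \<Rightarrow> 'v \<Rightarrow> 'v" where
  "word_op [] = (\<lambda>v. v)"
| "word_op (l # w) = (\<lambda>v. letter_op l (word_op w v))"

definition rep :: "('k, 'a) diff_words \<Rightarrow> 'v \<Rightarrow> 'v" where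
  "rep p v = (\<Sum>w\<in>Poly_Mapping.keys p. scale (Poly_Mapping.lookup p w) (word_op w v))"

lemma letter_op_linear:
  "letter_op l (v + w) = letter_op l v + letter_op l w"
  "letter_op l (scale c v) = scale c (letter_op l v)"
  by (induction l arbitrary: v w rule: letter_op.induct)
    (auto simp: X_add X_scale D_add D_scale algebra_simps)

lemma word_op_linear:
  "word_op u (v + w) = word_op u v + word_op u w"
  "word_op u (scale c v) = scale c (word_op u v)"
  by (induction u) (auto simp: letter_op_linear)

lemma word_op_append: "word_op (u @ w) v = word_op u (word_op w v)"
  by (induction u) auto

lemma rep_linear:
  "rep p (v + w) = rep p v + rep p w"
  "rep p (scale c v) = scale c (rep p v)"
  by (simp_all add: rep_def word_op_linear sum.distrib scale_right_distrib scale_sum_right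
      mult.commute[of c])

lemma rep_add: "rep (p + q) v = rep p v + rep q v"
  unfolding rep_def
  by (rule setsum_keys_plus_distrib) (auto simp: algebra_simps)

lemma rep_scale: "rep (scale_words c p) v = scale c (rep p v)"
proof (cases "c = 0")
  case True
  then have "scale_words c p = 0" by (auto intro!: poly_mapping_eqI)
  with True show ?thesis by (simp add: rep_def)
next
  case False
  then have "Poly_Mapping.keys (scale_words c p) = Poly_Mapping.keys p"
    by (auto simp: in_keys_iff)
  then show ?thesis by (simp add: rep_def scale_sum_right)
qed

lemma linear_rep: "Vector_Spaces.linear scale_words (\<lambda>c T v. scale c (T v)) rep"
  unfolding Vector_Spaces.linear_iff
  using vector_space_scale_words vector_space_fun[OF vector_space_axioms]
  by (auto simp: fun_eq_iff rep_add rep_scale)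

lemma rep_single: "rep (Poly_Mapping.single w 1) = word_op w"
  by (auto simp: rep_def)

definition ops :: "('v \<Rightarrow> 'v) set" where "ops = range rep"

lemma ops_word_op: "word_op w \<in> ops"
  unfolding ops_def by (metis rangeI rep_single)

lemma ops_add: "S \<in> ops \<Longrightarrow> T \<in> ops \<Longrightarrow> (\<lambda>v. S v + T v) \<in> ops"
  unfolding ops_def by (auto simp flip: rep_add)

lemma ops_scale: "T \<in> ops \<Longrightarrow> (\<lambda>v. scale c (T v)) \<in> ops"
  unfolding ops_def by (auto simp flip: rep_scale)

lemma ops_zero: "(\<lambda>v. 0) \<in> ops"
  using ops_scale[OF ops_word_op[of "[]"], of 0] by simp

lemma ops_induct [consumes 1, case_names zero add scale word]:
  assumes "T \<in> ops"
    and zero: "P (\<lambda>v. 0)"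
    and add: "\<And>S T. S \<in> ops \<Longrightarrow> T \<in> ops \<Longrightarrow> P S \<Longrightarrow> P T \<Longrightarrow> P (\<lambda>v. S v + T v)"
    and scale: "\<And>c T. T \<in> ops \<Longrightarrow> P T \<Longrightarrow> P (\<lambda>v. scale c (T v))"
    and word: "\<And>w. P (word_op w)"
  shows "P T"
proof -
  obtain p where p: "T = rep p" using assms(1) by (auto simp: ops_def)
  \<comment> \<open>Membership in \<open>ops\<close> is carried along because \<open>add\<close> and
    \<open>scale\<close> demand it of the partial sums.\<close>
  have "P (\<lambda>v. \<Sum>w\<in>A. scale (Poly_Mapping.lookup p w) (word_op w v)) \<and>
    (\<lambda>v. \<Sum>w\<in>A. scale (Poly_Mapping.lookup p w) (word_op w v)) \<in> ops" if "finite A" for A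
    using that
  proof (induction A)
    case empty
    then show ?case by (simp add: zero ops_zero)
  next
    case (insert w A)
    then show ?case by (simp add: add scale word ops_add ops_scale ops_word_op)
  qed
  from this[OF finite_keys, of p] show ?thesis
    by (simp add: p rep_def[abs_def])
qed

lemma ops_comp:
  assumes "S \<in> ops" "T \<in> ops"
  shows "(\<lambda>v. S (T v)) \<in> ops"
  using assms(1)
proof (induction rule: ops_induct)
  case (word u)
  show ?case using assms(2)
  proof (induction rule: ops_induct)
    case zero
    then show ?case using word_op_linear(2)[of u 0 0] ops_zero by simp
  next
    case (word w)
    then show ?case using ops_word_op[of "u @ w"] by (simp add: word_op_append[abs_def])
  qed (simp_all add: word_op_linear ops_add ops_scale)
qed (simp_all add: ops_zero ops_add ops_scale)

text \<open>\<open>D\<close> need not lie in \<open>ops\<close>. The commutator with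
  \<open>D\<close> obeys the Leibniz rule on words, and on a letter it only raises the order of the
  derivative by one.\<close>

lemma ops_commutator:
  assumes "T \<in> ops"
  shows "(\<lambda>v. D (T v) - T (D v)) \<in> ops"
  using assms
proof (induction rule: ops_induct)
  case zero
  then show ?case using D_scale[of 0 0] ops_zero by simp
next
  case (add S T)
  from ops_add[OF add(3,4)] show ?case by (simp add: D_add algebra_simps)
next
  case (scale c T)
  from ops_scale[OF scale(2), of c] show ?case by (simp add: D_scale algebra_simps)
next
  case (word w)
  show ?case
  proof (induction w)
    case Nil
    then show ?case by (simp add: ops_zero)
  next
    case (Cons l w)
    obtain n a where l: "l = (n, a)" by fastforce
    have "(\<lambda>v. letter_op l (D (word_op w v) - word_op w (D v))) \<in> ops"
      using ops_comp[OF ops_word_op[of "[l]"] Cons] by simp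
    from ops_add[OF ops_word_op[of "(Suc n, a) # w"] this]
    have "(\<lambda>v. D (letter_op l (word_op w v)) - letter_op l (D (word_op w v))
      + letter_op l (D (word_op w v) - word_op w (D v))) \<in> ops" by (simp add: l)
    moreover have "letter_op l (x - y) = letter_op l x - letter_op l y" for x y
      using letter_op_linear(1)[of l "x - y" y] by (simp add: algebra_simps)
    ultimately show ?case by simp
  qed
qed

text \<open>The algebra \<open>ops\<close> is transported along a linear section \<sigma> of
  \<open>rep\<close>. The word space is then the sum of the image of \<open>ops\<close> and the
  kernel of \<open>rep\<close>, on which product and derivation vanish.\<close>

lemma derivation_algebra_diff_words:
  obtains mult d \<sigma> where
    "derivation_algebra (scale_words :: 'k \<Rightarrow> ('k, 'a) diff_words \<Rightarrow> _) mult d"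
    "Vector_Spaces.linear (\<lambda>c T v. scale c (T v)) scale_words \<sigma>"
    "inj_on \<sigma> ops"
    "\<And>S T. S \<in> ops \<Longrightarrow> T \<in> ops \<Longrightarrow> mult (\<sigma> S) (\<sigma> T) = \<sigma> (\<lambda>v. S (T v))"
    "\<And>T. T \<in> ops \<Longrightarrow> d (\<sigma> T) = \<sigma> (\<lambda>v. D (T v) - T (D v))"
proof -
  interpret vp: vector_space_pair "scale_words :: 'k \<Rightarrow> ('k, 'a) diff_words \<Rightarrow> _" "\<lambda>c (T :: 'v \<Rightarrow> 'v) v. scale c (T v)"
    unfolding vector_space_pair_def
    using vector_space_scale_words vector_space_fun[OF vector_space_axioms] by blast
  obtain \<sigma> where lin: "Vector_Spaces.linear (\<lambda>c (T :: 'v \<Rightarrow> 'v) v. scale c (T v)) scale_words \<sigma>"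
    and rs: "\<And>T. T \<in> ops \<Longrightarrow> rep (\<sigma> T) = T"
    using vp.linear_exists_right_inverse_on[OF linear_rep vp.vs1.subspace_UNIV]
    unfolding ops_def by blast
  have sadd: "\<sigma> (\<lambda>v. S v + T v) = \<sigma> S + \<sigma> T" for S T
  proof -
    have "\<sigma> (S + T) = \<sigma> S + \<sigma> T"
      using lin unfolding Vector_Spaces.linear_iff by blast
    then show ?thesis by (simp only: plus_fun_def)
  qed
  have sscale: "\<sigma> (\<lambda>v. scale c (T v)) = scale_words c (\<sigma> T)" for c T
    using lin unfolding Vector_Spaces.linear_iff by simp
  define mult where "mult p q = \<sigma> (\<lambda>v. rep p (rep q v))" for p q
  define d where "d p = \<sigma> (\<lambda>v. D (rep p v) - rep p (D v))" for p
  have in_ops: "rep p \<in> ops" for p by (simp add: ops_def)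
  have rep_mult: "rep (mult p q) = (\<lambda>v. rep p (rep q v))" for p q
    unfolding mult_def by (rule rs[OF ops_comp[OF in_ops in_ops]])
  have rep_d: "rep (d p) = (\<lambda>v. D (rep p v) - rep p (D v))" for p
    unfolding d_def by (rule rs[OF ops_commutator[OF in_ops]])
  have "derivation_algebra (scale_words :: 'k \<Rightarrow> ('k, 'a) diff_words \<Rightarrow> _) mult d"
  proof (unfold_locales, unfold bilinear_op_def Vector_Spaces.linear_iff, safe)
    show "mult x (y + z) = mult x y + mult x z" for x y z
      by (simp add: mult_def rep_add rep_linear sadd)
    show "mult (y + z) x = mult y x + mult z x" for x y z
      by (simp add: mult_def rep_add rep_linear sadd)
    show "mult x (scale_words c y) = scale_words c (mult x y)" for x c y
      by (simp add: mult_def rep_scale rep_linear sscale)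
    show "mult (scale_words c y) x = scale_words c (mult y x)" for x c y
      by (simp add: mult_def rep_scale rep_linear sscale)
    show "mult (mult x y) z = mult x (mult y z)" for x y z
      by (simp add: mult_def[of "mult x y"] mult_def[of x "mult y z"] rep_mult)
    show "d (x + y) = d x + d y" for x y
      by (simp add: d_def rep_add D_add flip: sadd) (simp add: algebra_simps)
    show "d (scale_words c x) = scale_words c (d x)" for c x
      by (simp add: d_def rep_scale D_scale scale_right_diff_distrib flip: sscale)
    have rd: "rep a (x - y) = rep a x - rep a y" for a x y
      using rep_linear(1)[of a "x - y" y] by (simp add: algebra_simps)
    show "d (mult a b) = mult (d a) b + mult a (d b)" for a b
      by (simp add: d_def[of "mult a b"] mult_def[of "d a"] mult_def[of a "d b"]
           rep_mult rep_d rd flip: sadd)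
  qed (rule vector_space_scale_words)+
  moreover have "inj_on \<sigma> ops" by (metis inj_onI rs)
  moreover have "mult (\<sigma> S) (\<sigma> T) = \<sigma> (\<lambda>v. S (T v))" if "S \<in> ops" "T \<in> ops" for S T
    using that by (simp add: mult_def rs)
  moreover have "d (\<sigma> T) = \<sigma> (\<lambda>v. D (T v) - T (D v))" if "T \<in> ops" for T
    using that by (simp add: d_def rs)
  ultimately show ?thesis using that[of mult d \<sigma>] lin by simp
qed

end

text \<open>Composing all operators with a linear projection onto \<open>N\<close> makes relations
  that hold only on \<open>N\<close> hold everywhere.\<close>

lemma embedding_of_operators:
  fixes scale :: "'k::field \<Rightarrow> 'a::ab_group_add \<Rightarrow> 'a"
    and scaleV :: "'k \<Rightarrow> 'v::ab_group_add \<Rightarrow> 'v"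
  assumes "vector_space scale"
    and D: "Vector_Spaces.linear scaleV scaleV D"
    and X: "\<And>a. Vector_Spaces.linear scaleV scaleV (X a)"
    and N: "module.subspace scaleV N"
    and DN: "\<And>v. v \<in> N \<Longrightarrow> D v \<in> N"
    and XN: "\<And>a v. v \<in> N \<Longrightarrow> X a v \<in> N"
    and X_add: "\<And>a b v. v \<in> N \<Longrightarrow> X (a + b) v = X a v + X b v"
    and X_scale: "\<And>c a v. v \<in> N \<Longrightarrow> X (scale c a) v = scaleV c (X a v)"
    and X_prec: "\<And>a b v. v \<in> N \<Longrightarrow> X (prec a b) v = X a (D (X b v) - X b (D v))"
    and X_succ: "\<And>a b v. v \<in> N \<Longrightarrow> X (succ a b) v = D (X a (X b v)) - X a (D (X b v))"
    and faithful: "v0 \<in> N" "\<And>a. X a v0 = 0 \<Longrightarrow> a = 0"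
  shows "\<exists>(scaleA :: 'k \<Rightarrow> ('k, 'a) diff_words \<Rightarrow> ('k, 'a) diff_words) mult d \<iota>.
           derivation_algebra scaleA mult d \<and>
           Vector_Spaces.linear scale scaleA \<iota> \<and> inj \<iota> \<and>
           (\<forall>a b. \<iota> (prec a b) = der_prec mult d (\<iota> a) (\<iota> b)) \<and>
           (\<forall>a b. \<iota> (succ a b) = der_succ mult d (\<iota> a) (\<iota> b))"
proof -
  interpret vs: vector_space scale by fact
  interpret vp: vector_space_pair scaleV scaleV
    using D by (auto simp: Vector_Spaces.linear_iff vector_space_pair_def)
  obtain \<pi> where \<pi>: "\<And>v. \<pi> v \<in> N" "Vector_Spaces.linear scaleV scaleV \<pi>" "\<And>v. v \<in> N \<Longrightarrow> \<pi> v = v"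
    using vp.linear_exists_left_inverse_on[OF vp.vs1.linear_id N] by auto
  interpret m: operator_model scaleV "\<lambda>v. D (\<pi> v)" "\<lambda>a v. X a (\<pi> v)"
    using D X \<pi>(2) by unfold_locales (auto simp: Vector_Spaces.linear_iff)
  obtain mult d \<sigma> where
    alg: "derivation_algebra (scale_words :: 'k \<Rightarrow> ('k, 'a) diff_words \<Rightarrow> _) mult d"
    and lin: "Vector_Spaces.linear (\<lambda>c T v. scaleV c (T v)) scale_words \<sigma>"
    and inj: "inj_on \<sigma> m.ops"
    and mult: "\<And>S T. S \<in> m.ops \<Longrightarrow> T \<in> m.ops \<Longrightarrow> mult (\<sigma> S) (\<sigma> T) = \<sigma> (\<lambda>v. S (T v))"
    and d: "\<And>T. T \<in> m.ops \<Longrightarrow> d (\<sigma> T) = \<sigma> (\<lambda>v. D (\<pi> (T v)) - T (D (\<pi> v)))"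
    using m.derivation_algebra_diff_words by blast
  have X_ops: "(\<lambda>v. X a (\<pi> v)) \<in> m.ops" for a
    using m.ops_word_op[of "[(0, a)]"] by simp
  have X'_ops: "(\<lambda>v. D (\<pi> (X a (\<pi> v))) - X a (\<pi> (D (\<pi> v)))) \<in> m.ops" for a
    using m.ops_word_op[of "[(Suc 0, a)]"] by simp
  have N_diff: "x \<in> N \<Longrightarrow> y \<in> N \<Longrightarrow> x - y \<in> N" for x y
    using N by (rule vp.vs1.subspace_diff)
  define \<iota> where "\<iota> a = \<sigma> (\<lambda>v. X a (\<pi> v))" for a
  have "Vector_Spaces.linear scale scale_words \<iota>"
    unfolding Vector_Spaces.linear_iff
  proof safe
    show "\<iota> (a + b) = \<iota> a + \<iota> b" for a b
    proof -
      have "\<iota> (a + b) = \<sigma> ((\<lambda>v. X a (\<pi> v)) + (\<lambda>v. X b (\<pi> v)))"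
        by (simp add: \<iota>_def X_add \<pi> plus_fun_def)
      also have "\<dots> = \<iota> a + \<iota> b"
        using lin unfolding \<iota>_def Vector_Spaces.linear_iff by blast
      finally show ?thesis .
    qed
    show "\<iota> (scale c a) = scale_words c (\<iota> a)" for c a
      using lin by (simp add: \<iota>_def X_scale \<pi> Vector_Spaces.linear_iff)
  qed (rule vector_space_scale_words vs.vector_space_axioms)+
  moreover have "inj \<iota>"
  proof (rule injI)
    fix a b assume "\<iota> a = \<iota> b"
    then have "(\<lambda>v. X a (\<pi> v)) = (\<lambda>v. X b (\<pi> v))"
      using inj X_ops unfolding \<iota>_def inj_on_def by blast
    then have "X a v0 = X b v0" using faithful(1) \<pi>(3) by metis
    moreover have "X (a - b) v0 + X b v0 = X a v0"
      using X_add[OF faithful(1), of "a - b" b] by simp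
    ultimately have "X (a - b) v0 = 0" by simp
    from faithful(2)[OF this] show "a = b" by simp
  qed
  moreover have "\<iota> (prec a b) = der_prec mult d (\<iota> a) (\<iota> b)" for a b
    unfolding der_prec_def \<iota>_def d[OF X_ops] mult[OF X_ops X'_ops]
    by (simp add: X_prec \<pi> DN XN N_diff)
  moreover have "\<iota> (succ a b) = der_succ mult d (\<iota> a) (\<iota> b)" for a b
    unfolding der_succ_def \<iota>_def d[OF X_ops] mult[OF X'_ops X_ops]
    by (simp add: X_succ \<pi> DN XN N_diff)
  ultimately show ?thesis using alg by blast
qed

subsection \<open>Balanced multilinear functions\<close>

type_synonym 'a state = "('a list \<Rightarrow> 'a) \<times> (('a list \<Rightarrow> 'a) \<Rightarrow> 'a)"

context nc_novikov_algebra
begin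

definition lin :: "('a \<Rightarrow> 'a) \<Rightarrow> bool" where
  "lin h \<longleftrightarrow> (\<forall>x y. h (x + y) = h x + h y) \<and> (\<forall>c x. h (scale c x) = scale c (h x))"

lemma linD:
  assumes "lin h"
  shows "h (x + y) = h x + h y" "h (scale c x) = scale c (h x)" "h 0 = 0" "h (x - y) = h x - h y"
proof -
  show add: "h (x + y) = h x + h y" for x y using assms by (auto simp: lin_def)
  show "h (scale c x) = scale c (h x)" using assms by (auto simp: lin_def)
  show "h 0 = 0" using add[of 0 0] by simp
  show "h (x - y) = h x - h y" using add[of "x - y" y] by (simp add: algebra_simps)
qed

lemma lin_prec: "lin (\<lambda>x. x \<prec> y)" "lin (\<lambda>y. x \<prec> y)"
  and lin_succ: "lin (\<lambda>x. x \<succ> y)" "lin (\<lambda>y. x \<succ> y)"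
  using bilinear_prec bilinear_succ
  by (auto simp: lin_def bilinear_op_def Vector_Spaces.linear_iff)

lemmas prec_simps = lin_prec[THEN linD(1)] lin_prec[THEN linD(2)] lin_prec[THEN linD(3)] lin_prec[THEN linD(4)]
lemmas succ_simps = lin_succ[THEN linD(1)] lin_succ[THEN linD(2)] lin_succ[THEN linD(3)] lin_succ[THEN linD(4)]

lemma lin_zero: "lin (\<lambda>x. 0)"
  and lin_id: "lin (\<lambda>x. x)"
  and lin_add: "lin h \<Longrightarrow> lin k \<Longrightarrow> lin (\<lambda>x. h x + k x)"
  and lin_diff: "lin h \<Longrightarrow> lin k \<Longrightarrow> lin (\<lambda>x. h x - k x)"
  and lin_scale: "lin (scale c)"
  and lin_if: "lin h \<Longrightarrow> lin (\<lambda>x. if P then 0 else h x)"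
  and lin_comp: "lin h \<Longrightarrow> lin k \<Longrightarrow> lin (\<lambda>x. h (k x))"
  by (auto simp: lin_def algebra_simps scale_right_diff_distrib)

text \<open>A function on lists of all lengths encodes a linear map to \<open>D\<close> from the
  direct sum of the tensor powers, so that no tensor product has to be constructed.\<close>

definition multilinear :: "('a list \<Rightarrow> 'a) \<Rightarrow> bool" where
  "multilinear g \<longleftrightarrow> (\<forall>u v. lin (\<lambda>x. g (u @ x # v)))"

definition balanced :: "('a list \<Rightarrow> 'a) \<Rightarrow> bool" where
  "balanced g \<longleftrightarrow> (\<forall>u a b c v. g (u @ (a \<prec> c) # b # v) = g (u @ a # (c \<succ> b) # v))"

lemma multilinearD:
  assumes "multilinear g"
  shows "lin (\<lambda>x. g (u @ x # v))" "lin (\<lambda>x. g (x # v))" "lin (\<lambda>x. g (b # x # v))"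
proof -
  show *: "lin (\<lambda>x. g (u @ x # v))" for u v
    using assms by (auto simp: multilinear_def)
  show "lin (\<lambda>x. g (x # v))" "lin (\<lambda>x. g (b # x # v))"
    using *[of "[]" v] *[of "[b]" v] by simp_all
qed

lemma multilinear_lin:
  assumes "multilinear g" "lin k"
  shows "lin (\<lambda>x. g (k x # v))" "lin (\<lambda>x. g (b # k x # v))"
  using lin_comp[OF multilinearD(2)[OF assms(1)] assms(2)]
    lin_comp[OF multilinearD(3)[OF assms(1)] assms(2)] .

lemma balancedD:
  assumes "balanced g"
  shows "g (u @ (a \<prec> c) # b # v) = g (u @ a # (c \<succ> b) # v)"
    "g ((a \<prec> c) # b # v) = g (a # (c \<succ> b) # v)"
    "g (e # (a \<prec> c) # b # v) = g (e # a # (c \<succ> b) # v)"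
proof -
  show *: "g (u @ (a \<prec> c) # b # v) = g (u @ a # (c \<succ> b) # v)" for u
    using assms by (simp add: balanced_def)
  show "g ((a \<prec> c) # b # v) = g (a # (c \<succ> b) # v)"
    "g (e # (a \<prec> c) # b # v) = g (e # a # (c \<succ> b) # v)"
    using *[of "[]"] *[of "[e]"] by simp_all
qed

lemma multilinear_Cons: "multilinear g \<Longrightarrow> multilinear (\<lambda>u. g (b # u))"
  unfolding multilinear_def by (simp flip: append_Cons)

lemma balanced_Cons: "balanced g \<Longrightarrow> balanced (\<lambda>u. g (b # u))"
  unfolding balanced_def by (simp flip: append_Cons)

lemma multilinear_snoc: "multilinear g \<Longrightarrow> multilinear (\<lambda>u. g (u @ [b]))"
  unfolding multilinear_def by simp

lemma balanced_snoc: "balanced g \<Longrightarrow> balanced (\<lambda>u. g (u @ [b]))"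
  unfolding balanced_def by simp

lemma multilinear_comp: "lin L \<Longrightarrow> multilinear g \<Longrightarrow> multilinear (\<lambda>u. L (g u))"
  unfolding multilinear_def
proof safe
  fix u v
  assume "lin L" "\<forall>u v. lin (\<lambda>x. g (u @ x # v))"
  then show "lin (\<lambda>x. L (g (u @ x # v)))"
    by (intro lin_comp[of L "\<lambda>x. g (u @ x # v)"]) auto
qed

lemma balanced_comp: "balanced g \<Longrightarrow> balanced (\<lambda>u. L (g u))"
  unfolding balanced_def by simp

lemma multilinear_add: "multilinear g \<Longrightarrow> multilinear h \<Longrightarrow> multilinear (\<lambda>u. g u + h u)"
  unfolding multilinear_def by (auto intro: lin_add)

lemma balanced_add: "balanced g \<Longrightarrow> balanced h \<Longrightarrow> balanced (\<lambda>u. g u + h u)"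
  unfolding balanced_def by simp

text \<open>With \<open>a # r\<close> standing for the product of its entries, this is the sum of all terms of
  the derivative of the product in which an entry of \<open>r\<close> is differentiated; the derivative is
  absorbed by a neighbour, via \<open>b' c = b \<succ> c\<close> and, for the last entry, \<open>a b' = a \<prec> b\<close>.\<close>

fun merges :: "('a list \<Rightarrow> 'a) \<Rightarrow> 'a \<Rightarrow> 'a list \<Rightarrow> 'a" where
  "merges g a [] = 0"
| "merges g a [b] = g [a \<prec> b]"
| "merges g a (b # c # r) = g (a # (b \<succ> c) # r) + merges (\<lambda>u. g (a # u)) b (c # r)"

text \<open>This evaluates \<open>g\<close> at the derivative of the whole product; the first
  summand differentiates the leading entry. Shorter lists offer no neighbour to absorb a
  derivative.\<close>

fun contract :: "('a list \<Rightarrow> 'a) \<Rightarrow> 'a list \<Rightarrow> 'a" where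
  "contract g (a # b # r) = g ((a \<succ> b) # r) + merges g a (b # r)"
| "contract g u = 0"

lemma merges_add: "merges (\<lambda>u. g u + h u) a r = merges g a r + merges h a r"
  by (induction g a r arbitrary: h rule: merges.induct) auto

lemma merges_comp: "lin L \<Longrightarrow> merges (\<lambda>u. L (g u)) a r = L (merges g a r)"
  by (induction g a r rule: merges.induct) (auto simp: linD)

lemma contract_add: "contract (\<lambda>u. g u + h u) = (\<lambda>u. contract g u + contract h u)"
proof
  show "contract (\<lambda>u. g u + h u) u = contract g u + contract h u" for u
    by (cases u rule: remdups_adj.cases) (auto simp: merges_add)
qed

lemma contract_comp: "lin L \<Longrightarrow> contract (\<lambda>u. L (g u)) = (\<lambda>u. L (contract g u))"
proof
  assume "lin L"
  then show "contract (\<lambda>u. L (g u)) u = L (contract g u)" for u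
    by (cases u rule: remdups_adj.cases) (auto simp: merges_comp linD)
qed

lemma merges_cong:
  "(\<And>u. length u = length r \<Longrightarrow> h u = g u) \<Longrightarrow> merges h a r = merges g a r"
proof (induction h a r arbitrary: g rule: merges.induct)
  case (3 h a b c r)
  from "3.IH"[of "\<lambda>u. g (a # u)"] "3.prems" show ?case by simp
qed auto

text \<open>\<open>merges\<close> never differentiates the leading entry. Only a last entry absorbed
  into it affects it, and there the first axiom moves \<open>c \<succ> _\<close> inside.\<close>

lemma merges_shift:
  "(\<And>y s. h (y # s) = g ((c \<succ> y) # s)) \<Longrightarrow> merges h b r = merges g (c \<succ> b) r"
proof (induction h b r arbitrary: g rule: merges.induct)
  case (3 h a b c r)
  then show ?case by simp
qed (auto simp: succ_prec)

text \<open>The derivative of the last entry of \<open>r\<close> is absorbed to the right once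
  \<open>b\<close> follows, to the left otherwise; balancedness identifies the two. The extra term
  differentiates \<open>b\<close>.\<close>

lemma merges_snoc:
  assumes "balanced g"
  shows "merges g a (r @ [b]) = merges (\<lambda>u. g (u @ [b])) a r
    + g (butlast (a # r) @ [last (a # r) \<prec> b])"
  using assms
proof (induction g a r rule: merges.induct)
  case (2 g a c)
  then show ?case by (simp add: balancedD)
next
  case (3 g a c d r)
  from "3.IH"[OF balanced_Cons[OF "3.prems"]] show ?case by (simp add: add.assoc)
qed simp

lemma lin_merges_fun:
  "(\<And>u. lin (\<lambda>x. h x u)) \<Longrightarrow> lin (\<lambda>x. merges (h x) b r)"
\<comment> \<open>The rule follows a single function, so one member of the family, at an arbitrary
  parameter, drives the recursion.\<close>
proof (induction "h undefined" b r arbitrary: h rule: merges.induct)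
  case (3 a b c r)
  have "lin (\<lambda>x. merges (\<lambda>u. h x (a # u)) b (c # r))"
    by (rule "3.hyps"[of "\<lambda>x u. h x (a # u)"]) (auto simp: "3.prems")
  with "3.prems" show ?case by (auto intro: lin_add)
qed (auto simp: lin_zero)

lemma lin_merges_head:
  assumes "multilinear g"
  shows "lin (\<lambda>x. merges g x r)"
proof (cases r rule: remdups_adj.cases)
  case 1
  then show ?thesis by (simp add: lin_zero)
next
  case (2 b)
  with multilinear_lin(1)[OF assms lin_prec(1)] show ?thesis by simp
next
  case (3 b c s)
  have "lin (\<lambda>x. merges (\<lambda>u. g (x # u)) b (c # s))"
    by (rule lin_merges_fun) (rule multilinearD[OF assms])
  from lin_add[OF multilinearD(2)[OF assms] this] show ?thesis by (simp add: 3)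
qed

lemma lin_merges_tail:
  "multilinear g \<Longrightarrow> lin (\<lambda>x. merges g a (u @ x # v))"
proof (induction u arbitrary: g a)
  case Nil
  show ?case
  proof (cases v)
    case Nil
    with multilinear_lin(1)[OF \<open>multilinear g\<close> lin_prec(2)] show ?thesis by simp
  next
    case (Cons c s)
    with lin_add[OF multilinear_lin(2)[OF \<open>multilinear g\<close> lin_succ(1)]
        lin_merges_head[OF multilinear_Cons[OF \<open>multilinear g\<close>]]]
    show ?thesis by simp
  qed
next
  case (Cons b u)
  note IH = Cons.IH[OF multilinear_Cons[OF Cons.prems], of a b]
  show ?case
  proof (cases u)
    case Nil
    with lin_add[OF multilinear_lin(2)[OF Cons.prems lin_succ(2)] IH] show ?thesis by simp
  next
    case 2: (Cons c s)
    with lin_add[OF multilinearD(1)[OF Cons.prems, of "a # (b \<succ> c) # s" v] IH]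
    show ?thesis by simp
  qed
qed

text \<open>\<open>merges\<close> alone does not respect the tensor relation at its leading entry.
  By the second axiom the defect is exactly what differentiating the leading entry contributes, so
  it cancels in \<open>contract\<close>.\<close>

lemma merges_exchange:
  assumes "multilinear g" "balanced g"
  shows "merges g a ((c \<succ> b) # v) - merges g (a \<prec> c) (b # v)
    = g (((a \<prec> c) \<succ> b) # v) - g ((a \<succ> (c \<succ> b)) # v)"
proof (cases v)
  case Nil
  have "g [a \<prec> (c \<succ> b)] - g [(a \<prec> c) \<prec> b] = g [(a \<prec> c) \<succ> b] - g [a \<succ> (c \<succ> b)]"
    using linD(4)[OF multilinearD(2)[OF assms(1), of "[]"]] assoc_defect[of a c b] by metis
  with Nil show ?thesis by simp
next
  case (Cons x s)
  have "merges (\<lambda>u. g ((a \<prec> c) # u)) b (x # s) = merges (\<lambda>u. g (a # u)) (c \<succ> b) (x # s)"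
    by (rule merges_shift) (simp add: balancedD assms)
  then have "merges g a ((c \<succ> b) # v) - merges g (a \<prec> c) (b # v)
    = g (a # ((c \<succ> b) \<succ> x) # s) - g ((a \<prec> c) # (b \<succ> x) # s)"
    by (simp add: Cons)
  \<comment> \<open>Moving the factors off \<open>x\<close> brings the difference into the form of
    \<open>assoc_defect\<close>.\<close>
  also have "\<dots> = g ((a \<prec> (c \<succ> b)) # x # s) - g (((a \<prec> c) \<prec> b) # x # s)"
    by (simp add: balancedD assms)
  also have "\<dots> = g (((a \<prec> c) \<succ> b) # x # s) - g ((a \<succ> (c \<succ> b)) # x # s)"
    using linD(4)[OF multilinearD(2)[OF assms(1), of "x # s"]] assoc_defect[of a c b] by metis
  finally show ?thesis by (simp add: Cons)
qed

text \<open>Behind the entry \<open>e\<close> the derivative of \<open>a\<close> is a term of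
  \<open>merges\<close> too, which cancels the defect in \<open>merges_exchange\<close>.\<close>

lemma balanced_merges:
  assumes "multilinear g" "balanced g"
  shows "balanced (merges g e)"
proof -
  have "merges g e (u @ (a \<prec> c) # b # v) = merges g e (u @ a # (c \<succ> b) # v)" for u a b c v
    using assms
  proof (induction u arbitrary: g e)
    case Nil
    from merges_exchange[OF multilinear_Cons balanced_Cons, OF Nil, of e a c b v]
    show ?case by (simp add: algebra_simps)
  next
    case (Cons x u)
    from Cons.IH[OF multilinear_Cons balanced_Cons, OF Cons.prems, of e x]
    show ?case
      using Cons.prems balancedD(1)[OF Cons.prems(2), of "e # (x \<succ> hd u) # tl u" a c b v]
      by (cases u) (auto simp: succ_prec balancedD)
  qed
  then show ?thesis by (auto simp: balanced_def)
qed

lemma multilinear_contract: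
  assumes "multilinear g"
  shows "multilinear (contract g)"
proof -
  have "lin (\<lambda>x. contract g (u @ x # v))" for u v
  proof (cases u rule: remdups_adj.cases)
    case 1
    show ?thesis
    proof (cases v)
      case Nil
      with 1 show ?thesis by (simp add: lin_zero)
    next
      case (Cons c s)
      with 1 lin_add[OF multilinear_lin(1)[OF assms lin_succ(1)] lin_merges_head[OF assms]]
      show ?thesis by simp
    qed
  next
    case (2 b)
    with lin_add[OF multilinear_lin(1)[OF assms lin_succ(2)] lin_merges_tail[OF assms, of b "[]" v]]
    show ?thesis by simp
  next
    case (3 b e t)
    with lin_add[OF multilinearD(1)[OF assms, of "(b \<succ> e) # t" v]
        lin_merges_tail[OF assms, of b "e # t" v]]
    show ?thesis by simp
  qed
  then show ?thesis by (auto simp: multilinear_def)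
qed

lemma balanced_contract:
  assumes "multilinear g" "balanced g"
  shows "balanced (contract g)"
proof -
  have "contract g (u @ (a \<prec> c) # b # v) = contract g (u @ a # (c \<succ> b) # v)" for u a b c v
  proof (cases u)
    case Nil
    with merges_exchange[OF assms, of a c b v] show ?thesis by (simp add: algebra_simps)
  next
    case (Cons e s)
    show ?thesis
      using balancedD(1)[OF balanced_merges[OF assms], of e s a c b v]
        balancedD(1)[OF assms(2), of "(e \<succ> hd s) # tl s" a c b v]
      by (cases s) (auto simp: Cons succ_prec balancedD assms)
  qed
  then show ?thesis by (auto simp: balanced_def)
qed

text \<open>Test functions vanish on short lists because products of fewer than two elements of \<open>D\<close> do
  not belong to the part of weight below \<open>-1\<close>.\<close>

definition test :: "('a list \<Rightarrow> 'a) \<Rightarrow> bool" where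
  "test g \<longleftrightarrow> multilinear g \<and> balanced g \<and> (\<forall>u. length u < 2 \<longrightarrow> g u = 0)"

text \<open>Dual to left multiplication by \<open>a\<close> below weight \<open>-1\<close>. The
  cut-off keeps \<open>pre a g\<close> a test function; the lost value returns as
  \<open>g [a, f []]\<close> in \<open>mult_op\<close>.\<close>

definition pre :: "'a \<Rightarrow> ('a list \<Rightarrow> 'a) \<Rightarrow> 'a list \<Rightarrow> 'a" where
  "pre a g = (\<lambda>u. if length u < 2 then 0 else g (a # u))"

fun act_head :: "'a \<Rightarrow> ('a list \<Rightarrow> 'a) \<Rightarrow> 'a list \<Rightarrow> 'a" where
  "act_head b g [] = 0"
| "act_head b g (c # r) = g ((b \<succ> c) # r)"

text \<open>The derivative of a product of two elements of \<open>D\<close> lies in \<open>D\<close> again.\<close>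

fun pair_deriv :: "'a list \<Rightarrow> 'a" where
  "pair_deriv [a, b] = a \<succ> b + a \<prec> b"
| "pair_deriv u = 0"

lemma test_add: "test g \<Longrightarrow> test h \<Longrightarrow> test (\<lambda>u. g u + h u)"
  by (auto simp: test_def multilinear_add balanced_add)

lemma test_comp: "lin L \<Longrightarrow> test g \<Longrightarrow> test (\<lambda>u. L (g u))"
  by (auto simp: test_def multilinear_comp balanced_comp linD)

lemma test_pre: "test g \<Longrightarrow> test (pre a g)"
  using multilinear_Cons[of g a] balanced_Cons[of g a]
  by (auto simp: test_def pre_def multilinear_def balanced_def intro!: lin_if)

lemma test_contract: "test g \<Longrightarrow> test (contract g)"
proof -
  assume g: "test g"
  have "contract g u = 0" if "length u < 2" for u
    using that by (cases "(g, u)" rule: contract.cases) auto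
  with g show ?thesis by (auto simp: test_def multilinear_contract balanced_contract)
qed

lemma test_act_head:
  assumes "test g"
  shows "test (act_head b g)"
proof -
  have g: "multilinear g" "balanced g" "\<And>u. length u < 2 \<Longrightarrow> g u = 0"
    using assms by (auto simp: test_def)
  have "multilinear (act_head b g)"
    unfolding multilinear_def
  proof safe
    fix u v
    show "lin (\<lambda>x. act_head b g (u @ x # v))"
      using multilinearD(1)[OF g(1), of "(b \<succ> hd u) # tl u" v]
        multilinear_lin(1)[OF g(1) lin_succ(2)[of b]]
      by (cases u) auto
  qed
  moreover have "balanced (act_head b g)"
    unfolding balanced_def
  proof safe
    fix u a c e v
    show "act_head b g (u @ (a \<prec> e) # c # v) = act_head b g (u @ a # (e \<succ> c) # v)"
      using balancedD(1)[OF g(2), of "(b \<succ> hd u) # tl u" a e c v]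
      by (cases u) (auto simp: succ_prec balancedD g)
  qed
  moreover have "act_head b g u = 0" if "length u < 2" for u
    using that by (cases u) (auto simp: g)
  ultimately show ?thesis by (auto simp: test_def)
qed

lemma pair_deriv_eq_0: "length u \<noteq> 2 \<Longrightarrow> pair_deriv u = 0"
  by (cases u rule: pair_deriv.cases) auto

text \<open>Balancedness on pairs is a rearrangement of the second axiom.\<close>

lemma test_pair_deriv: "test pair_deriv"
proof -
  have "lin (\<lambda>x. pair_deriv (u @ x # v))" for u v
  proof (cases "length u + length v = 1")
    case True
    then consider y where "u = [y]" "v = []" | y where "u = []" "v = [y]"
      by (cases u; cases v) auto
    then show ?thesis
      by cases (simp_all add: lin_def prec_simps succ_simps scale_right_distrib)
  qed (simp add: pair_deriv_eq_0 lin_zero)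
  moreover have "pair_deriv (u @ (a \<prec> c) # b # v) = pair_deriv (u @ a # (c \<succ> b) # v)" for u a b c v
  proof (cases "u = [] \<and> v = []")
    case True
    with assoc_defect[of a c b] show ?thesis by (simp add: algebra_simps)
  qed (auto simp: pair_deriv_eq_0)
  ultimately show ?thesis by (auto simp: test_def multilinear_def balanced_def pair_deriv_eq_0)
qed

text \<open>Leibniz rule for \<open>b\<close> times \<open>u\<close>. If \<open>u\<close> is a pair,
  its derivative is a single entry, where \<open>pre b g\<close> is cut to 0; the last summand
  restores that term.\<close>

lemma pre_contract:
  assumes "test g"
  shows "pre b (contract g) = (\<lambda>u. (contract (pre b g) u + act_head b g u) + g [b, pair_deriv u])"
proof
  fix u
  have g: "multilinear g" "balanced g" "\<And>u. length u < 2 \<Longrightarrow> g u = 0"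
    using assms by (auto simp: test_def)
  have g0: "g [b, 0] = 0" and g_add: "g [b, x + y] = g [b, x] + g [b, y]" for x y
    using linD[OF multilinearD(3)[OF g(1), of b "[]"]] by auto
  show "pre b (contract g) u = (contract (pre b g) u + act_head b g u) + g [b, pair_deriv u]"
  proof (cases u rule: remdups_adj.cases)
    case (3 c e r)
    show ?thesis
    proof (cases r)
      case Nil
      with 3 show ?thesis by (simp add: pre_def g_add)
    next
      case (Cons x s)
      have "merges (pre b g) c (e # r) = merges (\<lambda>u. g (b # u)) c (e # r)"
        by (rule merges_cong) (simp add: pre_def Cons)
      with 3 Cons show ?thesis by (simp add: pre_def pair_deriv_eq_0 g0 algebra_simps)
    qed
  qed (auto simp: pre_def g g0)
qed

subsection \<open>The operators\<close>

text \<open>A state \<open>(f, z)\<close> stands for an element \<open>m\<close> of the graded space.  Its part of weight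
  at least \<open>-1\<close> is known through the values \<open>f [a\<^sub>1, \<dots>, a\<^sub>n] = a\<^sub>1 \<cdots> a\<^sub>n m\<close> in \<open>D\<close>, with
  \<open>f []\<close> the component of weight \<open>-1\<close>.  Its part of weight below \<open>-1\<close> is a combination
  of products \<open>a\<^sub>1 \<cdots> a\<^sub>n\<close> with \<open>n \<ge> 2\<close>, taken modulo multilinearity and balancedness; \<open>z\<close> is
  evaluation at this combination, a functional on test functions.\<close>

definition scale_state :: "'k \<Rightarrow> 'a state \<Rightarrow> 'a state" where
  "scale_state = (\<lambda>c (f, z). (\<lambda>u. scale c (f u), \<lambda>g. scale c (z g)))"

text \<open>Evaluation at a list is additive in \<open>g\<close> and commutes with every linear
  \<open>L\<close>; these two properties stand in for being a combination of evaluations.\<close>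

definition states :: "'a state set" where
  "states = {(f, z). multilinear f \<and> balanced f \<and>
     (\<forall>a c u. f ((c \<succ> a) # u) = c \<succ> f (a # u)) \<and>
     (\<forall>g h. test g \<longrightarrow> test h \<longrightarrow> z (\<lambda>u. g u + h u) = z g + z h) \<and>
     (\<forall>L g. lin L \<longrightarrow> test g \<longrightarrow> z (\<lambda>u. L (g u)) = L (z g))}"

text \<open>The summand \<open>g [a, f []]\<close> is the product of \<open>a\<close> with the
  component of weight \<open>-1\<close>. The value 0 off test functions lets equality be checked on
  test functions only.\<close>

definition mult_op :: "'a \<Rightarrow> 'a state \<Rightarrow> 'a state" where
  "mult_op a = (\<lambda>(f, z). (\<lambda>u. f (u @ [a]), \<lambda>g. if test g then z (pre a g) + g [a, f []] else 0))"

text \<open>Leibniz rule solved for \<open>a r m'\<close>: it is \<open>a (r m)'\<close>, that is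
  \<open>a \<prec> f r\<close>, minus the terms that differentiate an entry of \<open>r\<close>. The
  argument \<open>x\<close> is the component of \<open>m'\<close> of weight
  \<open>-1\<close>.\<close>

fun deriv_fun :: "('a list \<Rightarrow> 'a) \<Rightarrow> 'a \<Rightarrow> 'a list \<Rightarrow> 'a" where
  "deriv_fun f x [] = x"
| "deriv_fun f x (a # r) = a \<prec> f r - merges f a r"

definition deriv_op :: "'a state \<Rightarrow> 'a state" where
  "deriv_op = (\<lambda>(f, z). (deriv_fun f (z pair_deriv), \<lambda>g. if test g then z (contract g) else 0))"

section \<open>Linearity of the operators and invariance of the states\<close>

lemma vector_space_scale_state: "vector_space scale_state"
  unfolding scale_state_def
  by (intro vector_space_prod vector_space_fun vector_space_axioms)

lemma testD:
  assumes "test g"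
  shows "multilinear g" "balanced g" "length u < 2 \<Longrightarrow> g u = 0"
  using assms by (auto simp: test_def)

lemma linear_mult_op: "Vector_Spaces.linear scale_state scale_state (mult_op a)"
proof -
  have "g [a, x + y] = g [a, x] + g [a, y]" "g [a, scale c x] = scale c (g [a, x])"
    if "test g" for g x y c
    using linD[OF multilinearD(3)[OF testD(1)[OF that], of a "[]"]] by auto
  then show ?thesis
    unfolding Vector_Spaces.linear_iff
    using vector_space_scale_state
    by (auto simp: mult_op_def scale_state_def fun_eq_iff algebra_simps)
qed

lemma deriv_fun_add:
  "deriv_fun (\<lambda>u. f u + h u) (x + y) u = deriv_fun f x u + deriv_fun h y u"
  by (cases u) (auto simp: merges_add prec_simps)

lemma deriv_fun_scale:
  "deriv_fun (\<lambda>u. scale c (f u)) (scale c x) u = scale c (deriv_fun f x u)"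
  by (cases u) (auto simp: merges_comp lin_scale prec_simps scale_right_diff_distrib)

lemma linear_deriv_op: "Vector_Spaces.linear scale_state scale_state deriv_op"
  unfolding Vector_Spaces.linear_iff
  using vector_space_scale_state
  by (auto simp: deriv_op_def scale_state_def fun_eq_iff plus_fun_def
      deriv_fun_add deriv_fun_scale)

lemma subspace_states: "module.subspace scale_state states"
proof -
  interpret v: vector_space scale_state by (rule vector_space_scale_state)
  show ?thesis
    unfolding v.subspace_def
    by (auto simp: states_def scale_state_def zero_prod_def multilinear_add balanced_add
      multilinear_comp[OF lin_scale] balanced_comp succ_simps plus_fun_def linD algebra_simps
      multilinear_def[of 0] balanced_def[of 0] lin_zero)
qed

lemma statesD:
  assumes "(f, z) \<in> states"
  shows "multilinear f" "balanced f" "f ((c \<succ> a) # u) = c \<succ> f (a # u)"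
    "test g \<Longrightarrow> test h \<Longrightarrow> z (\<lambda>u. g u + h u) = z g + z h"
    "lin L \<Longrightarrow> test g \<Longrightarrow> z (\<lambda>u. L (g u)) = L (z g)"
  using assms by (auto simp: states_def)

lemma pre_add: "pre a (\<lambda>u. g u + h u) = (\<lambda>u. pre a g u + pre a h u)"
  by (auto simp: pre_def)

lemma pre_comp: "lin L \<Longrightarrow> pre a (\<lambda>u. L (g u)) = (\<lambda>u. L (pre a g u))"
  by (auto simp: pre_def linD)

lemma mult_op_states:
  assumes "v \<in> states"
  shows "mult_op a v \<in> states"
proof -
  obtain f z where v: "v = (f, z)" by fastforce
  note s = statesD[OF assms[unfolded v]]
  show ?thesis
    unfolding v mult_op_def states_def
    by (auto simp: multilinear_snoc balanced_snoc s test_add test_comp test_pre pre_add pre_comp linD)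
qed

lemma multilinear_deriv_fun:
  assumes "multilinear f"
  shows "multilinear (deriv_fun f x)"
proof -
  have "lin (\<lambda>y. deriv_fun f x (u @ y # w))" for u w
  proof (cases u)
    case Nil
    with lin_diff[OF lin_prec(1) lin_merges_head[OF assms]] show ?thesis by simp
  next
    case (Cons e s)
    with lin_diff[OF lin_comp[OF lin_prec(2) multilinearD(1)[OF assms]] lin_merges_tail[OF assms]]
    show ?thesis by simp
  qed
  then show ?thesis by (simp add: multilinear_def)
qed

text \<open>At the front, the defect from \<open>merges_exchange\<close> cancels against the second
  axiom applied to \<open>a\<close>, \<open>c\<close> and \<open>f (b # w)\<close>.\<close>

lemma balanced_deriv_fun:
  assumes "multilinear f" "balanced f" "\<And>a c u. f ((c \<succ> a) # u) = c \<succ> f (a # u)"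
  shows "balanced (deriv_fun f x)"
proof -
  have "deriv_fun f x (u @ (a \<prec> c) # b # w) = deriv_fun f x (u @ a # (c \<succ> b) # w)" for u a b c w
  proof (cases u)
    case Nil
    have "merges f a ((c \<succ> b) # w) - merges f (a \<prec> c) (b # w)
      = (a \<prec> c) \<succ> f (b # w) - a \<succ> (c \<succ> f (b # w))"
      using merges_exchange[OF assms(1,2)] by (simp add: assms(3))
    then show ?thesis
      using assoc_defect[of a c "f (b # w)"] by (simp add: Nil assms(3) algebra_simps)
  next
    case (Cons e s)
    then show ?thesis
      by (simp add: balancedD[OF assms(2)] balancedD[OF balanced_merges[OF assms(1,2)]])
  qed
  then show ?thesis by (simp add: balanced_def)
qed

lemma deriv_op_states:
  assumes "v \<in> states"
  shows "deriv_op v \<in> states"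
proof -
  obtain f z where v: "v = (f, z)" by fastforce
  note s = statesD[OF assms[unfolded v]]
  have "deriv_fun f x ((c \<succ> a) # u) = c \<succ> deriv_fun f x (a # u)" for x a c u
    using merges_shift[of "\<lambda>u. c \<succ> f u" f c a u]
    by (simp add: s(3) merges_comp lin_succ succ_simps succ_prec)
  then show ?thesis
    unfolding v deriv_op_def states_def
    by (auto simp: multilinear_deriv_fun balanced_deriv_fun s test_add test_comp test_contract
        contract_add contract_comp)
qed

text \<open>Multiplication by \<open>b'\<close>, the commutator of \<open>deriv_op\<close> and \<open>mult_op b\<close>, acts on the two
  components of a state by \<open>act_last\<close> and \<open>act_head\<close>.\<close>

fun act_last :: "'a \<Rightarrow> ('a list \<Rightarrow> 'a) \<Rightarrow> 'a list \<Rightarrow> 'a" where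
  "act_last b f [] = b \<succ> f []"
| "act_last b f (a # r) = f (butlast (a # r) @ [last (a # r) \<prec> b])"

lemma commutator:
  assumes "(f, z) \<in> states"
  shows "deriv_op (mult_op b (f, z)) - mult_op b (deriv_op (f, z))
    = (act_last b f, \<lambda>g. if test g then z (act_head b g) else 0)"
proof -
  note s = statesD[OF assms]
  define f' where "f' = (\<lambda>u. f (u @ [b]))"
  have zpd: "z (pre b pair_deriv) = 0"
  proof -
    \<comment> \<open>\<open>pre b\<close> evaluates \<open>pair_deriv\<close> only at lists of at
      least three entries.\<close>
    have "pre b pair_deriv = (\<lambda>u. 0)" by (auto simp: pre_def pair_deriv_eq_0)
    with s(5)[OF lin_zero test_pair_deriv] show ?thesis by simp
  qed
  have "deriv_fun f' (z (pre b pair_deriv) + pair_deriv [b, f []]) u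
      - deriv_fun f (z pair_deriv) (u @ [b]) = act_last b f u" for u
  proof (cases u)
    \<comment> \<open>Of \<open>pair_deriv [b, f []]\<close> only \<open>b \<succ> f []\<close>
      survives the subtraction of \<open>b \<prec> f []\<close>.\<close>
    case Nil
    then show ?thesis by (simp add: zpd)
  next
    case (Cons a r)
    then show ?thesis by (simp add: f'_def merges_snoc[OF s(2)])
  qed
  moreover have "z (pre b (contract g)) + contract g [b, f []] - (z (contract (pre b g)) + g [b, z pair_deriv])
    = z (act_head b g)" if g: "test g" for g
  proof -
    have L: "lin (\<lambda>x. g [b, x])" using multilinearD(3)[OF testD(1)[OF g]] .
    have "z (pre b (contract g)) = (z (contract (pre b g)) + z (act_head b g)) + g [b, z pair_deriv]"
      unfolding pre_contract[OF g]
        s(4)[OF test_add[OF test_contract[OF test_pre[OF g]] test_act_head[OF g]]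
          test_comp[OF L test_pair_deriv]]
        s(4)[OF test_contract[OF test_pre[OF g]] test_act_head[OF g]]
        s(5)[OF L test_pair_deriv] ..
    moreover have "contract g [b, f []] = 0" using g by (simp add: testD)
    ultimately show ?thesis by simp
  qed
  ultimately show ?thesis
    by (auto simp: deriv_op_def mult_op_def f'_def fun_eq_iff test_pair_deriv test_pre test_contract)
qed

section \<open>The two embedding identities for the operators\<close>

lemma act_last_snoc: "act_last b f (u @ [a]) = f (u @ [a \<prec> b])"
  by (cases u) auto

lemma mult_op_prec:
  assumes "v \<in> states"
  shows "mult_op (a \<prec> b) v = mult_op a (deriv_op (mult_op b v) - mult_op b (deriv_op v))"
proof -
  obtain f z where v: "v = (f, z)" by fastforce
  note s = statesD[OF assms[unfolded v]]
  \<comment> \<open>Balancedness of \<open>g\<close> at its first two entries.\<close>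
  have "pre (a \<prec> b) g = act_head b (pre a g)" if "test g" for g
  proof
    fix u
    show "pre (a \<prec> b) g u = act_head b (pre a g) u"
      using testD[OF that] by (cases u) (auto simp: pre_def balancedD)
  qed
  then show ?thesis
    unfolding v commutator[OF assms[unfolded v]]
    by (auto simp: mult_op_def act_last_snoc test_pre balancedD testD intro!: ext)
qed

lemma mult_op_succ:
  assumes "v \<in> states"
  shows "mult_op (a \<succ> b) v = deriv_op (mult_op a (mult_op b v)) - mult_op a (deriv_op (mult_op b v))"
proof -
  obtain f z where v: "v = (f, z)" by fastforce
  note s = statesD[OF assms[unfolded v]]
  obtain f' z' where v': "mult_op b v = (f', z')" by fastforce
  have f': "f' = (\<lambda>u. f (u @ [b]))" and z': "z' = (\<lambda>g. if test g then z (pre b g) + g [b, f []] else 0)"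
    using v' by (auto simp: v mult_op_def)
  \<comment> \<open>Balancedness handles nonempty \<open>u\<close>; the empty list needs that
    \<open>f\<close> commutes with \<open>a \<succ> _\<close>.\<close>
  have "f (u @ [a \<succ> b]) = act_last a f' u" for u
    using s(3)[of a b "[]"] by (cases u rule: rev_cases) (auto simp: f' act_last_snoc balancedD[OF s(2)])
  moreover have "pre (a \<succ> b) g = pre b (act_head a g)" for g
    by (auto simp: pre_def)
  ultimately have "mult_op (a \<succ> b) v = (act_last a f', \<lambda>g. if test g then z' (act_head a g) else 0)"
    by (auto simp: v z' mult_op_def test_act_head intro!: ext)
  also have "\<dots> = deriv_op (mult_op a (f', z')) - mult_op a (deriv_op (f', z'))"
    using mult_op_states[OF assms, of b] by (simp add: commutator v')
  finally show ?thesis by (simp add: v')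
qed

end

theorem theorem2:
  fixes scale :: "'k::field \<Rightarrow> 'a::ab_group_add \<Rightarrow> 'a"
    and prec succ :: "'a \<Rightarrow> 'a \<Rightarrow> 'a"
  assumes "nc_novikov_algebra scale prec succ"
  shows "\<exists>(scaleA :: 'k \<Rightarrow> ('k, 'a) diff_words \<Rightarrow> ('k, 'a) diff_words) mult d \<iota>.
           derivation_algebra scaleA mult d \<and>
           Vector_Spaces.linear scale scaleA \<iota> \<and> inj \<iota> \<and>
           (\<forall>a b. \<iota> (prec a b) = der_prec mult d (\<iota> a) (\<iota> b)) \<and>
           (\<forall>a b. \<iota> (succ a b) = der_succ mult d (\<iota> a) (\<iota> b))"
proof -
  interpret nc_novikov_algebra scale prec succ by fact
  \<comment> \<open>The identity map of \<open>D\<close>, as an element of weight 0: it behaves like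
    a right unit, so multiplying it by \<open>a\<close> recovers \<open>a\<close>.\<close>
  define e where "e u = (case u of [a] \<Rightarrow> a | _ \<Rightarrow> 0)" for u :: "'a list"
  have e: "e [a] = a" "length u \<noteq> 1 \<Longrightarrow> e u = 0" for a u
    by (auto simp: e_def split: list.split)
  show ?thesis
  proof (rule embedding_of_operators[OF vector_space_axioms linear_deriv_op linear_mult_op
        subspace_states deriv_op_states mult_op_states])
    fix v :: "'a state" and a b c
    assume v: "v \<in> states"
    obtain f z where fz: "v = (f, z)" by fastforce
    note s = statesD[OF v[unfolded fz]]
    have m: "g (u @ [a + b]) = g (u @ [a]) + g (u @ [b])" "g (u @ [scale c a]) = scale c (g (u @ [a]))"
      "g ((a + b) # u) = g (a # u) + g (b # u)" "g (scale c a # u) = scale c (g (a # u))"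
      if "multilinear g" for g u
      using linD[OF multilinearD(1)[OF that, of u "[]"]] linD[OF multilinearD(2)[OF that, of u]]
      by auto
    have "pre (a + b) g = (\<lambda>u. pre a g u + pre b g u)" "pre (scale c a) g = (\<lambda>u. scale c (pre a g u))"
      if "test g" for g
      using m[OF testD(1)[OF that]] by (auto simp: pre_def)
    then show "mult_op (a + b) v = mult_op a v + mult_op b v"
      "mult_op (scale c a) v = scale_state c (mult_op a v)"
      using m(1,2)[OF s(1)] m(3,4)[OF testD(1)]
      by (auto simp: fz mult_op_def scale_state_def s(4) s(5)[OF lin_scale] test_pre algebra_simps
          intro!: ext)
  next
    have "multilinear e" unfolding multilinear_def
    proof safe
      fix u v show "lin (\<lambda>x. e (u @ x # v))"
        by (cases "u = [] \<and> v = []") (auto simp: e lin_id lin_zero)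
    qed
    moreover have "balanced e" by (simp add: balanced_def e)
    moreover have "e (succ c a # u) = succ c (e (a # u))" for a c u
      by (cases "u = []") (auto simp: e succ_simps)
    ultimately show "(e, \<lambda>_. 0) \<in> states"
      by (auto simp: states_def linD)
  next
    fix a
    assume "mult_op a (e, \<lambda>_. 0) = 0"
    then have "e ([] @ [a]) = 0" by (auto simp: mult_op_def zero_prod_def fun_eq_iff simp del: append_Nil)
    then show "a = 0" by (simp add: e)
  qed (auto intro: mult_op_prec mult_op_succ)
qed
end
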